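(* Let $\beta\in\mathbb R$ and $\gamma>0$. The LI-CFP scheme is uniquely solvable. That is: given $\mathbf U^0\in\mathbb V_h$ and $\mathbf U^{(\frac12)}\in\mathbb V_h$, there is exactly one $\mathbf U^1\in\mathbb V_h$ with $$\mathrm i\delta_t^+\mathbf U^0+\mathbf\Delta_h\mathbf U^{\frac12}+\beta e^{-2\gamma t_{1/2}}|\mathbf U^{(\frac12)}|^2\cdot\mathbf U^{\frac12}=0,$$ and for every $n=1,\dots,M-1$, given $\mathbf U^{n-1},\mathbf U^n\in\mathbb V_h$, there is exactly one $\mathbf U^{n+1}\in\mathbb V_h$ with $$\mathrm i\delta_t\mathbf U^n+\mathbf\Delta_h\widehat{\mathbf U}^n+\beta e^{-2\gamma t_n}|\mathbf U^n|^2\cdot\widehat{\mathbf U}^n=0.$$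
   Context: Grid: $\Omega=[0,l_1]\times[0,l_2]\times[0,l_3]$; $N_1,N_2,N_3$ are even positive integers, $h_r=l_r/N_r$, $J_h=\{\vec j=(j_1,j_2,j_3):0\le j_r\le N_r-1,\ r=1,2,3\}$. $\mathbb V_h$ is the space of complex grid functions $\mathbf U=(U_{\vec j})_{\vec j\in J_h}$, extended periodically with period $N_r$ in the index $j_r$. The dot $\cdot$ between grid functions is the componentwise product and $|\mathbf U|^2=\mathbf U\cdot\bar{\mathbf U}$. Fourier pseudo-spectral Laplacian: for $r=1,2,3$ let $\mu_r=2\pi/l_r$, let $w^{(r)}_j=jh_r$, let $g^{(r)}_j(w)=\frac1{N_r}\sum_{l=-N_r/2}^{N_r/2}\frac1{a_l}e^{\mathrm il\mu_r(w-w^{(r)}_j)}$ with $a_l=1$ for $|l|<N_r/2$ and $a_l=2$ for $|l|=N_r/2$, and let $\mathbf D^{(r)}$ be the real symmetric $N_r\times N_r$ matrix with entries $(\mathbf D^{(r)})_{k,j}=\frac{d^2g^{(r)}_j}{dw^2}(w^{(r)}_k)$, $0\le k,j\le N_r-1$. Then $$(\mathbf\Delta_h\mathbf U)_{\vec j}=\sum_{j=0}^{N_1-1}(\mathbf D^{(1)})_{j_1,j}U_{j,j_2,j_3}+\sum_{k=0}^{N_2-1}(\mathbf D^{(2)})_{j_2,k}U_{j_1,k,j_3}+\sum_{m=0}^{N_3-1}(\mathbf D^{(3)})_{j_3,m}U_{j_1,j_2,m}.$$ Time discretization: $T>0$, $M$ a positive integer, $\tau=T/M$, $t_n=n\tau$,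 $t_{1/2}=\tau/2$; $\delta_t\mathbf U^n=\frac{\mathbf U^{n+1}-\mathbf U^{n-1}}{2\tau}$, $\delta_t^+\mathbf U^n=\frac{\mathbf U^{n+1}-\mathbf U^n}\tau$, $\widehat{\mathbf U}^n=\frac{\mathbf U^{n+1}+\mathbf U^{n-1}}2$, $\mathbf U^{n+\frac12}=\frac{\mathbf U^{n+1}+\mathbf U^n}2$. In the scheme, $\mathbf U^{(\frac12)}$ is a known grid function computed explicitly from the initial data. *)

theory Defs
  imports "HOL-Analysis.Analysis"
begin

type_synonym grid_fun = "int \<times> int \<times> int \<Rightarrow> complex"

definition index_set :: "nat \<Rightarrow> nat \<Rightarrow> nat \<Rightarrow> (int \<times> int \<times> int) set" where
  "index_set N1 N2 N3 = {0..<int N1} \<times> {0..<int N2} \<times> {0..<int N3}"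

text \<open>Grid functions live on all of \<open>\<int>\<^sup>3\<close>, so that the periodic extension is part of the
  function: an element is determined by its values on \<^const>\<open>index_set\<close>.\<close>

definition grid_space :: "nat \<Rightarrow> nat \<Rightarrow> nat \<Rightarrow> grid_fun set" where
  "grid_space N1 N2 N3 = {U. \<forall>j1 j2 j3.
      U (j1 + int N1, j2, j3) = U (j1, j2, j3) \<and>
      U (j1, j2 + int N2, j3) = U (j1, j2, j3) \<and>
      U (j1, j2, j3 + int N3) = U (j1, j2, j3)}"

definition node :: "nat \<Rightarrow> real \<Rightarrow> int \<Rightarrow> real" where
  "node N len j = of_int j * (len / real N)"

definition trig_weight :: "nat \<Rightarrow> int \<Rightarrow> complex" where
  "trig_weight N m = (if \<bar>m\<bar> < int N div 2 then 1 else 2)"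

definition trig_basis :: "nat \<Rightarrow> real \<Rightarrow> int \<Rightarrow> real \<Rightarrow> complex" where
  "trig_basis N len j w =
     (1 / of_nat N) * (\<Sum>m = - (int N div 2)..int N div 2.
        (1 / trig_weight N m) *
        exp (\<i> * of_int m * of_real (2 * pi / len) * of_real (w - node N len j)))"

text \<open>The entries are real; they are kept in type \<^typ>\<open>complex\<close>, the type of the complex-valued
  formula for \<^const>\<open>trig_basis\<close> that is differentiated (with respect to a real variable).\<close>

definition diff_matrix :: "nat \<Rightarrow> real \<Rightarrow> int \<Rightarrow> int \<Rightarrow> complex" where
  "diff_matrix N len k j =
     vector_derivative (\<lambda>w. vector_derivative (trig_basis N len j) (at w)) (at (node N len k))"

definition discrete_laplacian ::
    "nat \<Rightarrow> nat \<Rightarrow> nat \<Rightarrow> real \<Rightarrow> real \<Rightarrow> real \<Rightarrow> grid_fun \<Rightarrow> grid_fun" where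
  "discrete_laplacian N1 N2 N3 l1 l2 l3 U = (\<lambda>(j1, j2, j3).
      (\<Sum>j\<in>{0..<int N1}. diff_matrix N1 l1 j1 j * U (j, j2, j3)) +
      (\<Sum>k\<in>{0..<int N2}. diff_matrix N2 l2 j2 k * U (j1, k, j3)) +
      (\<Sum>m\<in>{0..<int N3}. diff_matrix N3 l3 j3 m * U (j1, j2, m)))"

definition central_diff :: "real \<Rightarrow> grid_fun \<Rightarrow> grid_fun \<Rightarrow> grid_fun" where
  "central_diff \<tau> Uprev Unext = (\<lambda>j. (Unext j - Uprev j) / of_real (2 * \<tau>))"

definition forward_diff :: "real \<Rightarrow> grid_fun \<Rightarrow> grid_fun \<Rightarrow> grid_fun" where
  "forward_diff \<tau> U Unext = (\<lambda>j. (Unext j - U j) / of_real \<tau>)"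

definition grid_avg :: "grid_fun \<Rightarrow> grid_fun \<Rightarrow> grid_fun" where
  "grid_avg U V = (\<lambda>j. (V j + U j) / 2)"

definition grid_abs2 :: "grid_fun \<Rightarrow> grid_fun" where
  "grid_abs2 U = (\<lambda>j. U j * cnj (U j))"

definition first_step_eq ::
    "nat \<Rightarrow> nat \<Rightarrow> nat \<Rightarrow> real \<Rightarrow> real \<Rightarrow> real \<Rightarrow> real \<Rightarrow> real \<Rightarrow> real \<Rightarrow>
     grid_fun \<Rightarrow> grid_fun \<Rightarrow> grid_fun \<Rightarrow> bool" where
  "first_step_eq N1 N2 N3 l1 l2 l3 \<beta> \<gamma> \<tau> U0 Uhalf U1 \<longleftrightarrow>
     (\<forall>j\<in>index_set N1 N2 N3.
        \<i> * forward_diff \<tau> U0 U1 j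
        + discrete_laplacian N1 N2 N3 l1 l2 l3 (grid_avg U0 U1) j
        + of_real (\<beta> * exp (- 2 * \<gamma> * (\<tau> / 2))) * grid_abs2 Uhalf j * grid_avg U0 U1 j = 0)"

definition leapfrog_step_eq ::
    "nat \<Rightarrow> nat \<Rightarrow> nat \<Rightarrow> real \<Rightarrow> real \<Rightarrow> real \<Rightarrow> real \<Rightarrow> real \<Rightarrow> real \<Rightarrow> nat \<Rightarrow>
     grid_fun \<Rightarrow> grid_fun \<Rightarrow> grid_fun \<Rightarrow> bool" where
  "leapfrog_step_eq N1 N2 N3 l1 l2 l3 \<beta> \<gamma> \<tau> n Uprev U Unext \<longleftrightarrow>
     (\<forall>j\<in>index_set N1 N2 N3.
        \<i> * central_diff \<tau> Uprev Unext j
        + discrete_laplacian N1 N2 N3 l1 l2 l3 (grid_avg Uprev Unext) j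
        + of_real (\<beta> * exp (- 2 * \<gamma> * (real n * \<tau>))) * grid_abs2 U j * grid_avg Uprev Unext j = 0)"

end

theory Submission
  imports Defs
begin

text \<open>
  Both time steps have the same shape.  Writing \<open>W\<close> for the old level and \<open>V\<close> for the average of
  the old and the new level, the difference quotient is \<open>c (V - W)\<close> with a real \<open>c \<noteq> 0\<close>, so a
  step is a \<^emph>\<open>linear\<close> system \<open>(\<i>c + H) V = \<i>c W\<close>: the nonlinear factor is evaluated at known
  data, and hence enters \<open>H\<close> as multiplication by a real grid function.  The other part of \<open>H\<close>,
  the pseudo-spectral Laplacian, is Hermitian because differentiating twice multiplies the Fourier
  mode \<open>m\<close> by the real number \<open>-(m\<mu>)\<^sup>2\<close>.  So the quadratic form of \<open>\<i>c + H\<close> has imaginary part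
  \<open>c \<parallel>V\<parallel>\<^sup>2\<close>, which vanishes only for \<open>V = 0\<close>.  Such a definite system is uniquely solvable
  (\<open>definite_system_solvable\<close>, \<open>hermitian_shift_unique_solution\<close>), whatever the size of \<open>\<tau>\<close> and
  the sign of \<open>\<beta>\<close>.  A solution on one period box then extends to exactly one periodic grid
  function.
\<close>

section \<open>Linear systems with definite imaginary part\<close>

text \<open>The imaginary part is chosen because it isolates the shift in \<open>\<i>c + H\<close>.  Its definiteness is
  inherited by principal Schur complements, so Gaussian elimination never needs to exchange pivots:
  that is what makes the induction below work.\<close>

definition definite_on :: "'a set \<Rightarrow> ('a \<Rightarrow> 'a \<Rightarrow> complex) \<Rightarrow> bool" where
  "definite_on I A \<longleftrightarrow>
     (\<forall>x. Im (\<Sum>i\<in>I. cnj (x i) * (\<Sum>j\<in>I. A i j * x j)) = 0 \<longrightarrow> (\<forall>i\<in>I. x i = 0))"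

lemma definite_onD:
  assumes "definite_on I A" "Im (\<Sum>i\<in>I. cnj (x i) * (\<Sum>j\<in>I. A i j * x j)) = 0" "i \<in> I"
  shows "x i = 0"
  using assms unfolding definite_on_def by blast

text \<open>Testing with the unit vector at \<open>a\<close> shows that the pivot is nonzero.\<close>

lemma definite_on_diagonal_nonzero:
  assumes "finite I" "definite_on I A" "a \<in> I"
  shows "A a a \<noteq> 0"
proof
  assume 0: "A a a = 0"
  define x where "x i = (if i = a then 1 else 0 :: complex)" for i
  have "(\<Sum>i\<in>I. cnj (x i) * (\<Sum>j\<in>I. A i j * x j)) = (\<Sum>i\<in>I. if i = a then A a a else 0)"
    using assms by (intro sum.cong refl) (auto simp: x_def if_distrib cong: if_cong)
  also have "\<dots> = 0"
    using 0 by (intro sum.neutral) auto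
  finally have "x a = 0"
    by (intro definite_onD[OF assms(2) _ assms(3)]) simp
  thus False by (simp add: x_def)
qed

text \<open>The unknown at \<open>a\<close> is eliminated by choosing it such that row \<open>a\<close> of the system reads \<open>f\<close>.
  With \<open>f = 0\<close> this turns a vector on \<open>J\<close> into one on which both quadratic forms agree; with
  the right-hand side for \<open>f\<close> it is back substitution.\<close>

lemma schur_complement_rows:
  fixes A :: "'a \<Rightarrow> 'a \<Rightarrow> complex"
  assumes J: "finite J" "a \<notin> J" and pivot: "A a a \<noteq> 0"
    and x_a: "x a = (f - (\<Sum>j\<in>J. A a j * x j)) / A a a"
  shows "(\<Sum>j\<in>insert a J. A a j * x j) = f"
    and "(\<Sum>j\<in>insert a J. A i j * x j) =
           A i a * f / A a a + (\<Sum>j\<in>J. (A i j - A i a * A a j / A a a) * x j)"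
proof -
  show "(\<Sum>j\<in>insert a J. A a j * x j) = f"
    using J pivot by (simp add: x_a)
  have "(\<Sum>j\<in>J. (A i j - A i a * A a j / A a a) * x j) =
          (\<Sum>j\<in>J. A i j * x j) - A i a / A a a * (\<Sum>j\<in>J. A a j * x j)"
    by (simp add: sum_subtractf sum_distrib_left algebra_simps)
  thus "(\<Sum>j\<in>insert a J. A i j * x j) =
          A i a * f / A a a + (\<Sum>j\<in>J. (A i j - A i a * A a j / A a a) * x j)"
    using J pivot by (simp add: x_a field_simps)
qed

lemma definite_on_schur_complement:
  assumes J: "finite J" "a \<notin> J" and A: "definite_on (insert a J) A"
  shows "definite_on J (\<lambda>i j. A i j - A i a * A a j / A a a)"
  unfolding definite_on_def
proof (intro allI impI ballI)
  let ?B = "\<lambda>i j. A i j - A i a * A a j / A a a"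
  fix y i
  assume y: "Im (\<Sum>i\<in>J. cnj (y i) * (\<Sum>j\<in>J. ?B i j * y j)) = 0" and i: "i \<in> J"
  have pivot: "A a a \<noteq> 0"
    using definite_on_diagonal_nonzero[OF _ A] J by simp
  define x where "x = y(a := (0 - (\<Sum>j\<in>J. A a j * y j)) / A a a)"
  have xy: "x j = y j" if "j \<in> J" for j
    using that J by (auto simp: x_def)
  have "(\<Sum>j\<in>J. A a j * x j) = (\<Sum>j\<in>J. A a j * y j)"
    by (intro sum.cong) (auto simp: xy)
  hence x_a: "x a = (0 - (\<Sum>j\<in>J. A a j * x j)) / A a a"
    by (simp add: x_def)
  note rows = schur_complement_rows[where A = A and x = x and f = "0", OF J pivot x_a]
  have "(\<Sum>i\<in>insert a J. cnj (x i) * (\<Sum>j\<in>insert a J. A i j * x j)) =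
          (\<Sum>i\<in>J. cnj (x i) * (\<Sum>j\<in>insert a J. A i j * x j))"
    by (subst sum.insert[OF J], subst rows(1)) simp
  also have "\<dots> = (\<Sum>i\<in>J. cnj (y i) * (\<Sum>j\<in>J. ?B i j * y j))"
    by (subst rows(2)) (simp add: xy)
  finally have "x i = 0"
    using i y by (intro definite_onD[OF A]) auto
  thus "y i = 0" using xy[OF i] by simp
qed

lemma definite_system_solvable:
  assumes "finite I" "definite_on I A"
  shows "\<exists>x. \<forall>i\<in>I. (\<Sum>j\<in>I. A i j * x j) = f i"
  using assms
proof (induction I arbitrary: A f rule: finite_induct)
  case empty
  show ?case by simp
next
  case (insert a J)
  note J = insert.hyps
  have pivot: "A a a \<noteq> 0"
    using definite_on_diagonal_nonzero[OF _ insert.prems] J by simp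
  obtain y where y: "\<forall>i\<in>J. (\<Sum>j\<in>J. (A i j - A i a * A a j / A a a) * y j) =
      f i - A i a * f a / A a a"
    using insert.IH[OF definite_on_schur_complement[OF J insert.prems],
        of "\<lambda>i. f i - A i a * f a / A a a"] by blast
  define x where "x = y(a := (f a - (\<Sum>j\<in>J. A a j * y j)) / A a a)"
  have xy: "x j = y j" if "j \<in> J" for j
    using that J by (auto simp: x_def)
  have "(\<Sum>j\<in>J. A a j * x j) = (\<Sum>j\<in>J. A a j * y j)"
    by (intro sum.cong) (auto simp: xy)
  hence x_a: "x a = (f a - (\<Sum>j\<in>J. A a j * x j)) / A a a"
    by (simp add: x_def)
  note rows = schur_complement_rows[where A = A and x = x and f = "f a", OF J pivot x_a]
  have "(\<Sum>j\<in>insert a J. A i j * x j) = f i" if "i \<in> J" for i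
    using y that by (subst rows(2)) (simp add: xy)
  with rows(1)
  show ?case by (intro exI[of _ x]) auto
qed

text \<open>Exchanging the two summations shows that the quadratic form of a Hermitian matrix equals its
  own conjugate.\<close>

lemma Im_hermitian_form_eq_0:
  assumes "\<And>i j. i \<in> I \<Longrightarrow> j \<in> I \<Longrightarrow> H i j = cnj (H j i)"
  shows "Im (\<Sum>i\<in>I. cnj (x i) * (\<Sum>j\<in>I. H i j * x j)) = 0"
proof -
  let ?S = "\<Sum>i\<in>I. cnj (x i) * (\<Sum>j\<in>I. H i j * x j)"
  have "cnj ?S = (\<Sum>i\<in>I. \<Sum>j\<in>I. x i * (cnj (H i j) * cnj (x j)))"
    by (simp add: sum_distrib_left)
  also have "\<dots> = (\<Sum>j\<in>I. \<Sum>i\<in>I. x i * (cnj (H i j) * cnj (x j)))"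
    by (rule sum.swap)
  also have "\<dots> = (\<Sum>j\<in>I. \<Sum>i\<in>I. cnj (x j) * (H j i * x i))"
    by (intro sum.cong refl) (subst assms, auto)
  also have "\<dots> = ?S"
    by (simp add: sum_distrib_left)
  finally show ?thesis
    by (metis Reals_cnj_iff complex_is_Real_iff)
qed

lemma sum_row_add_diagonal:
  fixes d :: "'b :: semiring_0"
  assumes "finite I" "i \<in> I"
  shows "(\<Sum>j\<in>I. ((if j = i then d else 0) + h j) * x j) = d * x i + (\<Sum>j\<in>I. h j * x j)"
proof -
  have "((if j = i then d else 0) + h j) * x j = (if j = i then d * x i else 0) + h j * x j" for j
    by (simp add: distrib_right)
  thus ?thesis using assms by (simp add: sum.distrib)
qed

lemma hermitian_shift_definite:
  fixes c :: real
  assumes I: "finite I" and "c \<noteq> 0"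
    and H: "\<And>i j. i \<in> I \<Longrightarrow> j \<in> I \<Longrightarrow> H i j = cnj (H j i)"
  shows "definite_on I (\<lambda>i j. (if j = i then \<i> * of_real c else 0) + H i j)"
  unfolding definite_on_def
proof (intro allI impI)
  let ?A = "\<lambda>i j. (if j = i then \<i> * of_real c else 0) + H i j"
  fix x assume 0: "Im (\<Sum>i\<in>I. cnj (x i) * (\<Sum>j\<in>I. ?A i j * x j)) = 0"
  have row: "(\<Sum>j\<in>I. ?A i j * x j) = \<i> * of_real c * x i + (\<Sum>j\<in>I. H i j * x j)" if "i \<in> I" for i
    by (rule sum_row_add_diagonal[OF I that])
  have "(\<Sum>i\<in>I. cnj (x i) * (\<Sum>j\<in>I. ?A i j * x j)) =
      (\<Sum>i\<in>I. cnj (x i) * (\<i> * of_real c * x i)) + (\<Sum>i\<in>I. cnj (x i) * (\<Sum>j\<in>I. H i j * x j))"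
    by (simp add: row distrib_left sum.distrib)
  also have "(\<Sum>i\<in>I. cnj (x i) * (\<i> * of_real c * x i)) = \<i> * of_real (c * (\<Sum>i\<in>I. (cmod (x i))\<^sup>2))"
    by (simp add: sum_distrib_left complex_norm_square mult_ac flip: of_real_power)
  finally have split: "(\<Sum>i\<in>I. cnj (x i) * (\<Sum>j\<in>I. ?A i j * x j)) =
      \<i> * of_real (c * (\<Sum>i\<in>I. (cmod (x i))\<^sup>2)) +
      (\<Sum>i\<in>I. cnj (x i) * (\<Sum>j\<in>I. H i j * x j))" .
  have "Im (\<Sum>i\<in>I. cnj (x i) * (\<Sum>j\<in>I. H i j * x j)) = 0"
    by (rule Im_hermitian_form_eq_0[OF H])
  hence "c * (\<Sum>i\<in>I. (cmod (x i))\<^sup>2) = 0"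
    using 0 unfolding split plus_complex.sel by simp
  with \<open>c \<noteq> 0\<close> I show "\<forall>i\<in>I. x i = 0"
    by (simp add: sum_nonneg_eq_0_iff)
qed

lemma hermitian_shift_unique_solution:
  fixes c :: real
  assumes I: "finite I" and c: "c \<noteq> 0"
    and H: "\<And>i j. i \<in> I \<Longrightarrow> j \<in> I \<Longrightarrow> H i j = cnj (H j i)"
  shows "\<exists>x. \<forall>i\<in>I. \<i> * of_real c * x i + (\<Sum>j\<in>I. H i j * x j) = f i" (is "\<exists>x. ?eq x")
    and "\<lbrakk>\<forall>i\<in>I. \<i> * of_real c * x i + (\<Sum>j\<in>I. H i j * x j) = f i;
          \<forall>i\<in>I. \<i> * of_real c * y i + (\<Sum>j\<in>I. H i j * y j) = f i; k \<in> I\<rbrakk> \<Longrightarrow> x k = y k"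
proof -
  let ?A = "\<lambda>i j. (if j = i then \<i> * of_real c else 0) + H i j"
  have row: "(\<Sum>j\<in>I. ?A i j * x j) = \<i> * of_real c * x i + (\<Sum>j\<in>I. H i j * x j)"
    if "i \<in> I" for i x
    by (rule sum_row_add_diagonal[OF I that])
  have def: "definite_on I ?A"
    by (rule hermitian_shift_definite[OF I c H])
  show "\<exists>x. ?eq x"
    using definite_system_solvable[OF I def, of f] by (simp add: row)
  assume x: "\<forall>i\<in>I. \<i> * of_real c * x i + (\<Sum>j\<in>I. H i j * x j) = f i"
    and y: "\<forall>i\<in>I. \<i> * of_real c * y i + (\<Sum>j\<in>I. H i j * y j) = f i" and k: "k \<in> I"
  define z where "z i = x i - y i" for i
  have "(\<Sum>j\<in>I. ?A i j * z j) = 0" if "i \<in> I" for i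
  proof -
    have "(\<Sum>j\<in>I. ?A i j * z j) = (\<Sum>j\<in>I. ?A i j * x j) - (\<Sum>j\<in>I. ?A i j * y j)"
      by (simp add: z_def right_diff_distrib sum_subtractf)
    thus ?thesis using x y that by (simp add: row)
  qed
  hence "z k = 0"
    using k by (intro definite_onD[OF def]) auto
  thus "x k = y k" by (simp add: z_def)
qed

section \<open>The pseudo-spectral Laplacian is Hermitian\<close>

lemma exponential_sum_has_vector_derivative:
  fixes C B :: "'m \<Rightarrow> complex" and v w :: real
  shows "((\<lambda>w. \<Sum>m\<in>S. C m * exp (B m * of_real (w - v))) has_vector_derivative
           (\<Sum>m\<in>S. (C m * B m) * exp (B m * of_real (w - v)))) (at w)"
proof -
  have "((\<lambda>w. exp (B m * of_real (w - v))) has_vector_derivative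
          B m * exp (B m * of_real (w - v))) (at w)" for m
  proof -
    have "((\<lambda>w. B m * of_real (w - v)) has_vector_derivative B m) (at w)"
      by (auto intro!: derivative_eq_intros simp: has_vector_derivative_def
            scaleR_conv_of_real mult_ac)
    moreover have "(exp has_field_derivative exp (B m * of_real (w - v)))
        (at (B m * of_real (w - v)))"
      by (rule DERIV_exp)
    ultimately show ?thesis
      using field_vector_diff_chain_at by (fastforce simp: o_def)
  qed
  from has_vector_derivative_mult_right[OF this] show ?thesis
    by (intro has_vector_derivative_sum) (simp add: mult.assoc)
qed

lemma diff_matrix_eq:
  "diff_matrix N len k j =
     (\<Sum>m = - (int N div 2)..int N div 2.
        - of_real ((of_int m * (2 * pi / len))\<^sup>2) / (of_nat N * trig_weight N m) *
        exp (\<i> * of_real (of_int m * (2 * pi / len)) * of_real (node N len k - node N len j)))"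
proof -
  define S where "S = {- (int N div 2)..int N div 2}"
  define B where "B m = \<i> * of_real (of_int m * (2 * pi / len))" for m :: int
  define C where "C m = 1 / (of_nat N * trig_weight N m)" for m
  have basis: "trig_basis N len j = (\<lambda>w. \<Sum>m\<in>S. C m * exp (B m * of_real (w - node N len j)))"
    by (simp add: trig_basis_def S_def B_def C_def sum_distrib_left mult_ac fun_eq_iff)
  have "diff_matrix N len k j =
      (\<Sum>m\<in>S. (C m * B m * B m) * exp (B m * of_real (node N len k - node N len j)))"
    unfolding diff_matrix_def basis
      vector_derivative_at[OF exponential_sum_has_vector_derivative] by simp
  also have "\<dots> = (\<Sum>m\<in>S. - of_real ((of_int m * (2 * pi / len))\<^sup>2) / (of_nat N * trig_weight N m) *
      exp (B m * of_real (node N len k - node N len j)))"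
  proof (intro sum.cong refl)
    fix m
    have "B m * B m = - of_real ((of_int m * (2 * pi / len))\<^sup>2)"
      unfolding B_def power2_eq_square[symmetric] power_mult_distrib
      by (simp add: power_mult_distrib power_divide)
    thus "C m * B m * B m * exp (B m * of_real (node N len k - node N len j)) =
        - of_real ((of_int m * (2 * pi / len))\<^sup>2) / (of_nat N * trig_weight N m) *
        exp (B m * of_real (node N len k - node N len j))"
      by (simp add: C_def mult.assoc)
  qed
  finally show ?thesis
    by (simp add: S_def B_def)
qed

text \<open>Each Fourier mode is Hermitian by itself: its coefficient is real, and swapping the two
  nodes conjugates the exponential.\<close>

lemma diff_matrix_hermitian: "diff_matrix N len k j = cnj (diff_matrix N len j k)"
proof -
  have "cnj (trig_weight N m) = trig_weight N m" for m
    by (simp add: trig_weight_def)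
  hence coeff: "cnj (- of_real a / (of_nat N * trig_weight N m) * z) =
      - of_real a / (of_nat N * trig_weight N m) * cnj z" for a m z
    by simp
  have mode: "cnj (exp (\<i> * of_real a * of_real (t - s))) = exp (\<i> * of_real a * of_real (s - t))"
    for a s t
    by (simp add: exp_cnj algebra_simps)
  show ?thesis
    by (simp only: diff_matrix_eq cnj_sum coeff mode)
qed

definition laplacian_kernel ::
    "nat \<Rightarrow> nat \<Rightarrow> nat \<Rightarrow> real \<Rightarrow> real \<Rightarrow> real \<Rightarrow> int \<times> int \<times> int \<Rightarrow> int \<times> int \<times> int \<Rightarrow> complex"
  where
  "laplacian_kernel N1 N2 N3 l1 l2 l3 = (\<lambda>(j1, j2, j3) (k1, k2, k3).
     (if k2 = j2 then if k3 = j3 then diff_matrix N1 l1 j1 k1 else 0 else 0) +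
     (if k1 = j1 then if k3 = j3 then diff_matrix N2 l2 j2 k2 else 0 else 0) +
     (if k1 = j1 then if k2 = j2 then diff_matrix N3 l3 j3 k3 else 0 else 0))"

lemma laplacian_kernel_hermitian:
  "laplacian_kernel N1 N2 N3 l1 l2 l3 j k = cnj (laplacian_kernel N1 N2 N3 l1 l2 l3 k j)"
proof -
  obtain j1 j2 j3 k1 k2 k3 where "j = (j1, j2, j3)" "k = (k1, k2, k3)"
    by (metis prod_cases3)
  thus ?thesis
    by (auto simp: laplacian_kernel_def simp flip: diff_matrix_hermitian)
qed

lemma discrete_laplacian_eq_kernel_sum:
  assumes "j \<in> index_set N1 N2 N3"
  shows "discrete_laplacian N1 N2 N3 l1 l2 l3 U j =
           (\<Sum>k\<in>index_set N1 N2 N3. laplacian_kernel N1 N2 N3 l1 l2 l3 j k * U k)"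
proof -
  obtain j1 j2 j3 where j: "j = (j1, j2, j3)"
    by (rule prod_cases3)
  have [simp]: "(if b then z else 0) * u = (if b then z * u else 0)" for b and z u :: complex
    by simp
  have [simp]: "(\<Sum>k\<in>A. if b then g k else 0) = (if b then sum g A else 0)"
    for b A and g :: "int \<Rightarrow> complex"
    by simp
  show ?thesis
    using assms
    by (simp add: j discrete_laplacian_def laplacian_kernel_def index_set_def
        sum.cartesian_product' distrib_right sum.distrib)
qed

section \<open>Periodic grid functions\<close>

lemma periodic_int_mod:
  fixes g :: "int \<Rightarrow> 'a"
  assumes "\<And>j. g (j + p) = g j"
  shows "g (j mod p) = g j"
proof -
  have add: "g (j + int n * p) = g j" for j n
    by (induction n) (use assms in \<open>simp_all add: distrib_right add.assoc[symmetric] add.commute[of p]\<close>)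
  show ?thesis
  proof (cases "j div p \<ge> 0")
    case True
    thus ?thesis
      using add[of "j mod p" "nat (j div p)"] by (simp add: mod_mult_div_eq mult.commute)
  next
    case False
    thus ?thesis
      using add[of j "nat (- (j div p))"] by (simp add: minus_div_mult_eq_mod)
  qed
qed

definition reduce_index :: "nat \<Rightarrow> nat \<Rightarrow> nat \<Rightarrow> int \<times> int \<times> int \<Rightarrow> int \<times> int \<times> int" where
  "reduce_index N1 N2 N3 = (\<lambda>(j1, j2, j3). (j1 mod int N1, j2 mod int N2, j3 mod int N3))"

lemma reduce_index_in_index_set:
  assumes "N1 > 0" "N2 > 0" "N3 > 0"
  shows "reduce_index N1 N2 N3 j \<in> index_set N1 N2 N3"
  using assms by (auto simp: reduce_index_def index_set_def split: prod.splits)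

lemma reduce_index_id: "j \<in> index_set N1 N2 N3 \<Longrightarrow> reduce_index N1 N2 N3 j = j"
  by (auto simp: reduce_index_def index_set_def)

lemma reduce_index_comp_in_grid_space: "(\<lambda>j. V (reduce_index N1 N2 N3 j)) \<in> grid_space N1 N2 N3"
  by (simp add: grid_space_def reduce_index_def)

lemma grid_space_reduce_index:
  assumes "U \<in> grid_space N1 N2 N3"
  shows "U (reduce_index N1 N2 N3 j) = U j"
proof -
  obtain j1 j2 j3 where j: "j = (j1, j2, j3)"
    by (rule prod_cases3)
  have 1: "U (j1 + int N1, j2, j3) = U (j1, j2, j3)"
    and 2: "U (j1, j2 + int N2, j3) = U (j1, j2, j3)"
    and 3: "U (j1, j2, j3 + int N3) = U (j1, j2, j3)" for j1 j2 j3
    using assms by (simp_all add: grid_space_def)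
  show ?thesis
    using periodic_int_mod[of "\<lambda>i. U (i, j2 mod int N2, j3 mod int N3)", OF 1, of j1]
      periodic_int_mod[of "\<lambda>i. U (j1, i, j3 mod int N3)", OF 2, of j2]
      periodic_int_mod[of "\<lambda>i. U (j1, j2, i)", OF 3, of j3]
    by (simp add: j reduce_index_def)
qed

lemma grid_space_eqI:
  assumes "U \<in> grid_space N1 N2 N3" "V \<in> grid_space N1 N2 N3" "N1 > 0" "N2 > 0" "N3 > 0"
    and "\<And>j. j \<in> index_set N1 N2 N3 \<Longrightarrow> U j = V j"
  shows "U = V"
proof
  fix j
  show "U j = V j"
    using assms(6)[OF reduce_index_in_index_set[OF assms(3-5), of j]]
    by (simp add: grid_space_reduce_index assms(1,2))
qed

section \<open>Unique solvability of a time step\<close>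

text \<open>This covers both kinds of step: \<open>c\<close> is \<open>1 / \<tau>\<close> for the first step and \<open>1 / (2 \<tau>)\<close> for the
  later ones, and \<open>p\<close> is the real potential given by the known grid function.  The argument passes
  to the average as unknown, which doubles \<open>c\<close> because the increment is twice the difference
  between the average and the old level.\<close>

lemma averaged_step_unique:
  fixes c :: real and p :: "int \<times> int \<times> int \<Rightarrow> real"
  assumes N: "N1 > 0" "N2 > 0" "N3 > 0" and c: "c \<noteq> 0" and W: "W \<in> grid_space N1 N2 N3"
  shows "\<exists>!X. X \<in> grid_space N1 N2 N3 \<and>
           (\<forall>j\<in>index_set N1 N2 N3.
              \<i> * (of_real c * (X j - W j))
              + discrete_laplacian N1 N2 N3 l1 l2 l3 (grid_avg W X) j
              + of_real (p j) * grid_avg W X j = 0)"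
proof -
  let ?I = "index_set N1 N2 N3"
  let ?L = "discrete_laplacian N1 N2 N3 l1 l2 l3"
  define H where "H j k = (if k = j then of_real (p j) else 0) +
      laplacian_kernel N1 N2 N3 l1 l2 l3 j k" for j k
  define f where "f j = \<i> * of_real (2 * c) * W j" for j
  define sol where "sol V \<longleftrightarrow> (\<forall>j\<in>?I. \<i> * of_real (2 * c) * V j + (\<Sum>k\<in>?I. H j k * V k) = f j)" for V
  have fin: "finite ?I"
    by (simp add: index_set_def)
  have herm: "H j k = cnj (H k j)" for j k
    by (simp add: H_def laplacian_kernel_hermitian[of _ _ _ _ _ _ j k])
  have row: "(\<Sum>k\<in>?I. H j k * V k) = ?L V j + of_real (p j) * V j" if "j \<in> ?I" for j V
    unfolding H_def sum_row_add_diagonal[OF fin that]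
    by (simp add: discrete_laplacian_eq_kernel_sum that)
  have step_iff: "(\<forall>j\<in>?I. \<i> * (of_real c * (X j - W j)) + ?L (grid_avg W X) j
      + of_real (p j) * grid_avg W X j = 0) \<longleftrightarrow> sol (grid_avg W X)" for X
  proof -
    have "\<i> * (of_real c * (X j - W j)) = \<i> * of_real (2 * c) * grid_avg W X j - f j" for j
      by (simp add: f_def grid_avg_def field_simps)
    moreover have "a - b + l + q = 0 \<longleftrightarrow> a + (l + q) = b" for a b l q :: complex
      by (simp add: algebra_simps)
    ultimately show ?thesis
      unfolding sol_def by (simp only: row cong: ball_cong)
  qed
  have "2 * c \<noteq> 0" using c by simp
  note solve = hermitian_shift_unique_solution[where H = H and f = f, OF fin this herm]
  obtain V where V: "sol V"
    using solve(1) unfolding sol_def by blast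
  define X where "X = (\<lambda>j. (\<lambda>i. 2 * V i - W i) (reduce_index N1 N2 N3 j))"
  have X: "X \<in> grid_space N1 N2 N3"
    unfolding X_def by (rule reduce_index_comp_in_grid_space)
  have "grid_avg W X j = V j" if "j \<in> ?I" for j
    using that by (simp add: grid_avg_def X_def reduce_index_id)
  hence "sol (grid_avg W X)"
    using V unfolding sol_def by simp
  moreover have "Y = X" if "Y \<in> grid_space N1 N2 N3" "sol (grid_avg W Y)" for Y
  proof (rule grid_space_eqI[OF that(1) X N])
    fix j assume "j \<in> ?I"
    hence "grid_avg W Y j = grid_avg W X j"
      using solve(2) that(2) \<open>sol (grid_avg W X)\<close> unfolding sol_def by blast
    thus "Y j = X j" by (simp add: grid_avg_def)
  qed
  ultimately show ?thesis
    unfolding step_iff using X by blast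
qed

lemma of_real_mult_grid_abs2:
  "of_real a * grid_abs2 U j = of_real (a * (cmod (U j))\<^sup>2)"
  unfolding grid_abs2_def by (simp add: complex_norm_square del: of_real_power flip: of_real_power)

theorem mainTheorem4:
  fixes \<beta> \<gamma> T \<tau> l1 l2 l3 :: real and N1 N2 N3 M :: nat
  assumes "\<gamma> > 0"
    and "l1 > 0" and "l2 > 0" and "l3 > 0"
    and "N1 > 0" and "even N1" and "N2 > 0" and "even N2" and "N3 > 0" and "even N3"
    and "T > 0" and "M > 0" and "\<tau> = T / real M"
  shows "(\<forall>U0 \<in> grid_space N1 N2 N3. \<forall>Uhalf \<in> grid_space N1 N2 N3.
            \<exists>!U1. U1 \<in> grid_space N1 N2 N3 \<and>
              first_step_eq N1 N2 N3 l1 l2 l3 \<beta> \<gamma> \<tau> U0 Uhalf U1) \<and>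
         (\<forall>n \<in> {1..M - 1}. \<forall>Uprev \<in> grid_space N1 N2 N3. \<forall>U \<in> grid_space N1 N2 N3.
            \<exists>!Unext. Unext \<in> grid_space N1 N2 N3 \<and>
              leapfrog_step_eq N1 N2 N3 l1 l2 l3 \<beta> \<gamma> \<tau> n Uprev U Unext)"
proof -
  have \<tau>: "1 / \<tau> \<noteq> 0" "1 / (2 * \<tau>) \<noteq> 0"
    using assms by auto
  have fd: "forward_diff \<tau> U X j = of_real (1 / \<tau>) * (X j - U j)" for U X j
    by (simp add: forward_diff_def)
  have cd: "central_diff \<tau> U X j = of_real (1 / (2 * \<tau>)) * (X j - U j)" for U X j
    by (simp add: central_diff_def)
  show ?thesis
    unfolding first_step_eq_def leapfrog_step_eq_def fd cd of_real_mult_grid_abs2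
    by (intro conjI ballI averaged_step_unique assms \<tau>)
qed

end
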